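(* Let $n,k$ be positive integers. For any $g\in\mathfrak{S}_{kn}$, $$\omega^{(k^n)}(g)=\frac{\operatorname{wrdet}_k\bigl(P(g)\mathbb{I}_{n,k}\bigr)}{\operatorname{wrdet}_k\mathbb{I}_{n,k}}$$ holds.
   Context: $\mathfrak{S}_N$ is the symmetric group on $\{1,\dots,N\}$. For $\sigma\in\mathfrak{S}_N$, $\nu(\sigma)$ is $N$ minus the number of disjoint cycles of $\sigma$ (fixed points counted as cycles), and $P(\sigma)=(\delta_{i\,\sigma(j)})_{1\le i,j\le N}$ is the permutation matrix of $\sigma$. For $\alpha\in\mathbb{C}$ and an $N\times N$ complex matrix $B=(b_{ij})$, the $\alpha$-determinant is $\det_{\alpha}B=\sum_{\sigma\in\mathfrak{S}_N}\alpha^{\nu(\sigma)}\prod_{i=1}^N b_{\sigma(i)i}$. Let $\mathbf{1}_{p,q}$ be the $p\times q$ all-one matrix and $\otimes$ the Kronecker product of matrices, $A\otimes B=(a_{ij}B)_{i,j}$. For a $kn\times n$ complex matrix $A$, the $k$-wreath determinant is $\operatorname{wrdet}_kA=\det_{-1/k}(A\otimes\mathbf{1}_{1,k})$, i.e. the $\alpha$-determinant at $\alpha=-1/k$ of the $kn\times kn$ matrix obtained from $A$ by repeating each column $k$ times consecutively. Put $\mathbb{I}_{n,k}=I_n\otimes\mathbf{1}_{k,1}$, the $kn\times n$ matrix obtained from the identity matrix $I_n$ by repeating each row $k$ times consecutively. (One has $\operatorname{wrdet}_k\mathbb{I}_{n,k}=(k!/k^k)^n\neq0$.) $(k^n)$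 is the partition of $kn$ with $n$ parts, all equal to $k$. For partitions $\lambda,\mu\vdash N$, with $\chi^\lambda$ the irreducible character of $\mathfrak{S}_N$ corresponding to $\lambda$, $\mu!=\mu_1!\mu_2!\cdots$, and $\mathfrak{S}_\mu=\mathfrak{S}_{\mu_1}\times\mathfrak{S}_{\mu_2}\times\cdots\subset\mathfrak{S}_N$ the Young subgroup whose $i$-th factor consists of the permutations of the letters $m+1,\dots,m+\mu_i$ with $m=\sum_{j<i}\mu_j$, define $$\omega^\lambda_\mu(x)=\frac1{\mu!}\sum_{\tau\in\mathfrak{S}_\mu}\chi^\lambda(x\tau)\quad(x\in\mathfrak{S}_N),\qquad \omega^\lambda=\omega^\lambda_\lambda .$$ *)

theory Defs
  imports
    Complex_Main
    "HOL-Combinatorics.Permutations"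
    "HOL-Combinatorics.Orbits"
    "HOL-Library.Function_Algebras"
    "Jordan_Normal_Form.Matrix"
begin

text \<open>
  The symmetric group on \<open>N\<close> letters acts on \<open>{..<N}\<close> (letters are shifted by one so that they
  match the matrix indices); its elements are functions fixing every number outside \<open>{..<N}\<close>.
  A partition is the decreasing list of its parts.
\<close>

definition symgrp :: "nat \<Rightarrow> (nat \<Rightarrow> nat) set" where
  "symgrp N = {\<sigma>. \<sigma> permutes {..<N}}"


section \<open>Wreath determinants\<close>

text \<open>The cycles of \<open>\<sigma>\<close>, fixed points included, are identified with their supports.\<close>

definition nu :: "nat \<Rightarrow> (nat \<Rightarrow> nat) \<Rightarrow> nat" where
  "nu N \<sigma> = N - card (Orbits.orbit \<sigma> ` {..<N})"

definition perm_mat :: "nat \<Rightarrow> (nat \<Rightarrow> nat) \<Rightarrow> complex mat" where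
  "perm_mat N \<sigma> = mat N N (\<lambda>(i, j). if i = \<sigma> j then 1 else 0)"

text \<open>Only meant for square matrices.\<close>

definition alpha_det :: "complex \<Rightarrow> complex mat \<Rightarrow> complex" where
  "alpha_det \<alpha> B =
    (\<Sum>\<sigma> \<in> symgrp (dim_row B). \<alpha> ^ nu (dim_row B) \<sigma> * (\<Prod>i<dim_row B. B $$ (\<sigma> i, i)))"

definition kron :: "complex mat \<Rightarrow> complex mat \<Rightarrow> complex mat" where
  "kron A B = mat (dim_row A * dim_row B) (dim_col A * dim_col B)
     (\<lambda>(i, j). A $$ (i div dim_row B, j div dim_col B) * B $$ (i mod dim_row B, j mod dim_col B))"

definition ones_mat :: "nat \<Rightarrow> nat \<Rightarrow> complex mat" where
  "ones_mat p q = mat p q (\<lambda>_. 1)"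

text \<open>Only meant for matrices with \<open>k * n\<close> rows and \<open>n\<close> columns.\<close>

definition wrdet :: "nat \<Rightarrow> complex mat \<Rightarrow> complex" where
  "wrdet k A = alpha_det (- 1 / of_nat k) (kron A (ones_mat 1 k))"

definition rep_id_mat :: "nat \<Rightarrow> nat \<Rightarrow> complex mat" where
  "rep_id_mat n k = kron (1\<^sub>m n) (ones_mat k 1)"


section \<open>Young subgroups and tableaux\<close>

definition block :: "nat list \<Rightarrow> nat \<Rightarrow> nat set" where
  "block \<mu> i = {sum_list (take i \<mu>) ..< sum_list (take (Suc i) \<mu>)}"

definition young_subgroup :: "nat list \<Rightarrow> (nat \<Rightarrow> nat) set" where
  "young_subgroup \<mu> = {\<tau> \<in> symgrp (sum_list \<mu>). \<forall>i<length \<mu>. \<tau> ` block \<mu> i = block \<mu> i}"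

text \<open>
  The standard tableau of shape \<open>lam\<close> obtained by filling in \<open>0, 1, 2, \<dots>\<close> row by row: row \<open>i\<close>
  consists of the entries in \<open>block lam i\<close>, so \<open>young_subgroup lam\<close> is its row stabilizer.
\<close>

definition tab_row :: "nat list \<Rightarrow> nat \<Rightarrow> nat" where
  "tab_row lam x = (THE i. i < length lam \<and> x \<in> block lam i)"

definition tab_col :: "nat list \<Rightarrow> nat \<Rightarrow> nat" where
  "tab_col lam x = x - sum_list (take (tab_row lam x) lam)"

definition column_stabilizer :: "nat list \<Rightarrow> (nat \<Rightarrow> nat) set" where
  "column_stabilizer lam =
    {\<tau> \<in> symgrp (sum_list lam). \<forall>x<sum_list lam. tab_col lam (\<tau> x) = tab_col lam x}"


section \<open>Irreducible characters of the symmetric group\<close>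

text \<open>
  Elements of the group algebra of \<open>symgrp N\<close> over the complex numbers are the functions that
  vanish outside \<open>symgrp N\<close>; the product is convolution.
\<close>

type_synonym galg = "(nat \<Rightarrow> nat) \<Rightarrow> complex"

definition galg_carrier :: "nat \<Rightarrow> galg set" where
  "galg_carrier N = {x. \<forall>\<sigma>. \<sigma> \<notin> symgrp N \<longrightarrow> x \<sigma> = 0}"

definition galg_basis :: "(nat \<Rightarrow> nat) \<Rightarrow> galg" where
  "galg_basis g = (\<lambda>\<sigma>. if \<sigma> = g then 1 else 0)"

definition galg_scale :: "complex \<Rightarrow> galg \<Rightarrow> galg" where
  "galg_scale c x = (\<lambda>\<sigma>. c * x \<sigma>)"

definition galg_mult :: "nat \<Rightarrow> galg \<Rightarrow> galg \<Rightarrow> galg" where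
  "galg_mult N x y =
    (\<lambda>\<sigma>. if \<sigma> \<in> symgrp N then \<Sum>h\<in>symgrp N. x h * y (inv_into UNIV h \<circ> \<sigma>) else 0)"

interpretation galg: vector_space galg_scale
  by unfold_locales (auto simp: galg_scale_def fun_eq_iff algebra_simps)

text \<open>
  The trace of the restriction to \<open>W\<close> of a linear map leaving the finite-dimensional subspace \<open>W\<close>
  invariant; the choice of the basis is immaterial.
\<close>

definition trace_on :: "galg set \<Rightarrow> (galg \<Rightarrow> galg) \<Rightarrow> complex" where
  "trace_on W T =
    (let B = (SOME B. galg.independent B \<and> galg.span B = W)
     in \<Sum>b\<in>B. galg.representation B (T b) b)"

text \<open>The Young symmetrizer: row symmetrizer times column antisymmetrizer.\<close>

definition young_symmetrizer :: "nat list \<Rightarrow> galg" where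
  "young_symmetrizer lam = galg_mult (sum_list lam)
     (\<Sum>\<sigma>\<in>young_subgroup lam. galg_basis \<sigma>)
     (\<Sum>\<tau>\<in>column_stabilizer lam. galg_scale (of_int (sign \<tau>)) (galg_basis \<tau>))"

text \<open>
  The irreducible module of \<open>lam\<close> is the left ideal generated by the Young symmetrizer. In this
  standard labelling \<open>[N]\<close> gives the trivial and \<open>replicate N 1\<close> the sign representation.
\<close>

definition irrep :: "nat list \<Rightarrow> galg set" where
  "irrep lam = {galg_mult (sum_list lam) x (young_symmetrizer lam) | x. x \<in> galg_carrier (sum_list lam)}"

definition irr_char :: "nat list \<Rightarrow> (nat \<Rightarrow> nat) \<Rightarrow> complex" where
  "irr_char lam g = trace_on (irrep lam) (galg_mult (sum_list lam) (galg_basis g))"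

definition omega :: "nat list \<Rightarrow> nat list \<Rightarrow> (nat \<Rightarrow> nat) \<Rightarrow> complex" where
  "omega lam \<mu> x =
    1 / of_nat (prod_list (map fact \<mu>)) * (\<Sum>\<tau>\<in>young_subgroup \<mu>. irr_char lam (x \<circ> \<tau>))"

end

theory Submission
  imports Defs
begin

text \<open>
  The left side is the trace, on the irreducible module \<open>M = A e\<close> of the rectangular diagram, of \<open>g\<close>
  times the projection onto the vectors fixed by the row group \<open>H\<close>; here \<open>A\<close> is the group algebra,
  \<open>e = a b\<close> the Young symmetrizer, \<open>a\<close> the sum of the elements of \<open>H\<close> and \<open>b\<close> the signed sum of the
  column group. The fixed vectors form the line spanned by \<open>e\<close>, so the trace is the factor by which
  \<open>a g\<close>, divided by the order of \<open>H\<close>, multiplies \<open>e\<close>. On the right side, repeated columns make the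
  wreath determinant a coset sum, \<open>W g = (\<Sum>h\<in>H. (- 1 / k) ^ nu (g \<circ> h))\<close>. Everything therefore comes
  down to the identity \<open>a g e = card H * W g / W id * e\<close>, which also yields that the fixed vectors
  form a line.

  That identity is a uniqueness statement. Call a function \<open>u\<close> on the symmetric group spherical if it is
  invariant under \<open>H\<close> on both sides and, for every \<open>g\<close>, the sum of \<open>u (g \<circ> t)\<close> over the permutations \<open>t\<close>
  of any \<open>k + 1\<close> letters is zero. The second property is a Garnir relation, and straightening with it
  expresses every value of \<open>u\<close> through \<open>u id\<close>: a spherical function is determined by its value at the
  identity (\<open>spherical_function_zero\<close>).

  Both sides are spherical. Each coefficient of \<open>a g e\<close>, as a function of \<open>g\<close>, is so because
  among \<open>k + 1\<close> letters two share one of the \<open>k\<close> columns (\<open>col_sign_vanish\<close>). The function \<open>W\<close> is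
  so because \<open>nu\<close> is a class function and because the sum of \<open>x ^ nu\<close> over a coset of the symmetric group
  of \<open>m\<close> letters is a multiple of \<open>1 (1 + x) \<dots> (1 + (m - 1) x)\<close>, which is zero at \<open>x = - 1 / k\<close> for
  \<open>m = k + 1\<close> (\<open>cycle_sum_vanish\<close>). The same letter-by-letter computation gives the order of \<open>H\<close> and
  \<open>W id \<noteq> 0\<close>. Finally, the sum over \<open>t\<close> in \<open>H\<close> of the operators \<open>g t\<close> on \<open>M\<close> has rank one, so its trace
  can be read off directly (\<open>trace_on_sum_rank_one\<close>).
\<close>

abbreviation pinv :: "(nat \<Rightarrow> nat) \<Rightarrow> nat \<Rightarrow> nat" where
  "pinv \<equiv> inv_into UNIV"

section \<open>The cycle count\<close>

text \<open>
  Conjugation by \<open>c\<close> relabels the cycles, so \<open>nu\<close> is a class function; that is what lets a factor be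
  moved from one side of a product to the other in the sums below.
\<close>

lemma nu_conjugate:
  assumes "p permutes {..<N}" "c permutes {..<N}"
  shows "nu N (c \<circ> p \<circ> pinv c) = nu N p"
proof -
  have perm: "permutation p" using assms(1) by (auto simp: permutation_permutes)
  have "orbit (c \<circ> p \<circ> pinv c) (c x) = c ` orbit p x" for x
    by (rule orbit_inverse[symmetric])
      (auto simp: permutation_self_in_orbit[OF perm] permutes_inverses[OF assms(2)])
  hence "orbit (c \<circ> p \<circ> pinv c) ` c ` {..<N} = (`) c ` orbit p ` {..<N}"
    by (simp add: image_image)
  hence "card (orbit (c \<circ> p \<circ> pinv c) ` {..<N}) = card ((`) c ` orbit p ` {..<N})"
    by (simp add: permutes_image[OF assms(2)])
  also have "\<dots> = card (orbit p ` {..<N})"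
    by (rule card_image) (use permutes_inj[OF assms(2)] in \<open>auto simp: inj_on_def inj_image_eq_iff\<close>)
  finally show ?thesis by (simp add: nu_def)
qed

lemma nu_comp_commute:
  assumes "p permutes {..<N}" "q permutes {..<N}"
  shows "nu N (p \<circ> q) = nu N (q \<circ> p)"
proof -
  have "p \<circ> q = p \<circ> (q \<circ> p) \<circ> pinv p"
    using permutes_inverses[OF assms(1)] by (auto simp: fun_eq_iff)
  thus ?thesis
    by (simp add: nu_conjugate permutes_compose assms)
qed

text \<open>
  Composing with a transposition that involves the fixed point \<open>y\<close> of \<open>p\<close> inserts \<open>y\<close> into the cycle
  of \<open>b\<close> and changes nothing else: the cycles \<open>{y}\<close> and \<open>orbit p b\<close> are merged into one. All
  generating functions of \<open>nu\<close> are computed from this single step, by adding one letter at a time.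
\<close>

lemma nu_transpose_comp:
  assumes p: "p permutes {..<N}" and y: "y < N" "p y = y" and b: "b < N" "b \<noteq> y"
  shows "nu N (transpose y b \<circ> p) = Suc (nu N p)"
proof -
  define s where "s = transpose y b \<circ> p"
  have perm: "permutation p" using p by (auto simp: permutation_permutes)
  have "s permutes {..<N}"
    unfolding s_def by (intro permutes_compose p permutes_swap_id) (use y b in auto)
  hence perm_s: "permutation s" by (auto simp: permutation_permutes)
  have py: "p x = y \<longleftrightarrow> x = y" for x
    using permutes_inj[OF p] y by (metis injD)
  have sv: "s x = (if x = y then b else if p x = b then y else p x)" for x
    using y b py[of x] by (auto simp: s_def transpose_def)
  have "z \<noteq> y" if "z \<in> orbit p x" "x \<noteq> y" for x z
    using that by induction (auto simp: py)
  hence ynot: "y \<notin> orbit p x" if "x \<noteq> y" for x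
    using that by blast
  have orb_y: "orbit p y = {y}" using y by (simp add: orbit_eq_singleton_iff)
  have orb_s: "orbit s b = insert y (orbit p b)"
  proof (intro equalityI subsetI)
    fix z assume "z \<in> orbit s b"
    thus "z \<in> insert y (orbit p b)"
    proof induction
      case base thus ?case using b by (auto simp: sv intro: orbit.intros)
    next
      case (step z) thus ?case
        by (auto simp: sv permutation_self_in_orbit[OF perm] intro: orbit.intros)
    qed
  next
    have self: "b \<in> orbit s b" by (rule permutation_self_in_orbit[OF perm_s])
    have *: "p z \<in> orbit s b" if "z \<in> orbit s b" "z \<noteq> y" for z
      using orbit.step[OF that(1)] that(2) self by (auto simp: sv split: if_splits)
    have "z \<in> orbit s b \<and> z \<noteq> y" if "z \<in> orbit p b" for z
      using that
    proof induction
      case base thus ?case using *[OF self] b py by auto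
    next
      case (step z) thus ?case using * py by auto
    qed
    moreover have "y \<in> orbit s b"
    proof (rule orbit_swap)
      show "y \<in> orbit s y" by (rule permutation_self_in_orbit[OF perm_s])
      show "b \<in> orbit s y" using orbit.base[of s y] by (simp add: sv)
    qed
    ultimately show "z \<in> orbit s b" if "z \<in> insert y (orbit p b)" for z
      using that by auto
  qed
  have orb_eq: "orbit s x = orbit p x" if "x \<notin> insert y (orbit p b)" for x
  proof (rule orbit_cong)
    show "x \<in> orbit p x" by (rule permutation_self_in_orbit[OF perm])
    fix z assume z: "z \<in> orbit p x"
    have "b \<notin> orbit p x"
      using that orbit_swap[OF permutation_self_in_orbit[OF perm]] by blast
    moreover have "z \<noteq> y" using z ynot[of x] that by blast
    moreover have "p z \<noteq> b" using orbit.step[OF z] \<open>b \<notin> orbit p x\<close> by metis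
    ultimately show "s z = p z" by (simp add: sv)
  qed
  define R where "R = orbit p ` ({..<N} - insert y (orbit p b))"
  have orb_b: "orbit p b \<subseteq> {..<N}" using permutes_orbit_subset[OF p] b by simp
  have split: "{..<N} = ({..<N} - insert y (orbit p b)) \<union> insert y (orbit p b)"
    using orb_b y by auto
  have Op: "orbit p z = orbit p b" if "z \<in> orbit p b" for z
    using orbit_cyclic_eq3[OF cyclic_on_orbit'[OF perm] that] .
  have Os: "orbit s z = orbit s b" if "z \<in> insert y (orbit p b)" for z
    by (rule orbit_cyclic_eq3[OF cyclic_on_orbit'[OF perm_s]]) (use that orb_s in simp)
  have "orbit p ` {..<N} = R \<union> orbit p ` insert y (orbit p b)"
    unfolding R_def by (subst split) (rule image_Un)
  also have "orbit p ` insert y (orbit p b) = {{y}, orbit p b}"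
  proof -
    have "orbit p ` orbit p b = {orbit p b}"
      using Op permutation_self_in_orbit[OF perm, of b] by blast
    thus ?thesis by (simp add: orb_y)
  qed
  finally have 1: "orbit p ` {..<N} = insert {y} (insert (orbit p b) R)" by simp
  have "orbit s ` {..<N} = orbit s ` ({..<N} - insert y (orbit p b)) \<union> orbit s ` insert y (orbit p b)"
    by (subst split) (rule image_Un)
  also have "orbit s ` insert y (orbit p b) = {insert y (orbit p b)}"
    using Os orb_s by blast
  also have "orbit s ` ({..<N} - insert y (orbit p b)) = R"
    unfolding R_def by (rule image_cong) (auto intro!: orb_eq)
  finally have 2: "orbit s ` {..<N} = insert (insert y (orbit p b)) R" by simp
  have "\<exists>x\<in>X. x \<notin> insert y (orbit p b)" if "X \<in> R" for X
    using that permutation_self_in_orbit[OF perm] unfolding R_def by blast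
  hence notin: "insert y (orbit p b) \<notin> R" "orbit p b \<notin> R" "{y} \<notin> R" by blast+
  have fin: "finite R" by (simp add: R_def)
  have "{y} \<noteq> orbit p b" using ynot b by blast
  with 1 fin notin have cp: "card (orbit p ` {..<N}) = card R + 2" by simp
  from 2 fin notin have cs: "card (orbit s ` {..<N}) = card R + 1" by simp
  have "card (orbit p ` {..<N}) \<le> N" using card_image_le[of "{..<N}" "orbit p"] by simp
  thus ?thesis using cp cs by (simp add: nu_def flip: s_def)
qed

lemma nu_id [simp]: "nu N id = 0"
proof -
  have "orbit id ` {..<N} = (\<lambda>x. {x}) ` {..<N}"
    by (rule image_cong) (auto simp: orbit_eq_singleton_iff)
  moreover have "card ((\<lambda>x. {x}) ` {..<N}) = N"
    by (subst card_image) auto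
  ultimately show ?thesis by (simp add: nu_def)
qed

section \<open>Label-preserving permutations\<close>

text \<open>
  For the rectangular diagram with \<open>n\<close> rows of length \<open>k\<close>, filled row by row, the row group is the
  case \<open>l x = x div k\<close> and the column group the case \<open>l x = x mod k\<close>; a constant label gives the full
  symmetric group of \<open>A\<close>.
\<close>

definition label_stab :: "(nat \<Rightarrow> nat) \<Rightarrow> nat set \<Rightarrow> (nat \<Rightarrow> nat) set" where
  "label_stab l A = {s. s permutes A \<and> (\<forall>x. l (s x) = l x)}"

lemma label_stab_permutes: "s \<in> label_stab l A \<Longrightarrow> s permutes A"
  by (simp add: label_stab_def)

lemma finite_label_stab: "finite A \<Longrightarrow> finite (label_stab l A)"
  by (rule finite_subset[OF _ finite_permutations[of A]]) (auto simp: label_stab_def)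

lemma id_in_label_stab: "id \<in> label_stab l A"
  by (simp add: label_stab_def)

lemma label_stab_comp: "s \<in> label_stab l A \<Longrightarrow> t \<in> label_stab l A \<Longrightarrow> s \<circ> t \<in> label_stab l A"
  by (auto simp: label_stab_def permutes_compose)

lemma label_stab_pinv: "s \<in> label_stab l A \<Longrightarrow> pinv s \<in> label_stab l A"
  unfolding label_stab_def by (auto simp: permutes_inv) (metis permutes_inverses(1))

lemma pinv_o: "s permutes A \<Longrightarrow> pinv s \<circ> (s \<circ> t) = t" "s permutes A \<Longrightarrow> s \<circ> (pinv s \<circ> t) = t"
  "s permutes A \<Longrightarrow> t \<circ> s \<circ> pinv s = t" "s permutes A \<Longrightarrow> t \<circ> pinv s \<circ> s = t"
  by (auto simp: fun_eq_iff permutes_inverses)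

lemma sum_label_stab_left:
  assumes "t \<in> label_stab l A"
  shows "(\<Sum>s\<in>label_stab l A. f (t \<circ> s)) = (\<Sum>s\<in>label_stab l A. f s)"
  by (rule sum.reindex_bij_witness[where i = "\<lambda>s. pinv t \<circ> s" and j = "\<lambda>s. t \<circ> s"])
    (use assms in \<open>auto simp: pinv_o[OF label_stab_permutes[OF assms]]
      intro: label_stab_comp label_stab_pinv\<close>)

lemma sum_label_stab_right:
  assumes "t \<in> label_stab l A"
  shows "(\<Sum>s\<in>label_stab l A. f (s \<circ> t)) = (\<Sum>s\<in>label_stab l A. f s)"
  by (rule sum.reindex_bij_witness[where i = "\<lambda>s. s \<circ> pinv t" and j = "\<lambda>s. s \<circ> t"])
    (use assms in \<open>auto simp: pinv_o[OF label_stab_permutes[OF assms]]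
      intro: label_stab_comp label_stab_pinv\<close>)

lemma sum_label_stab_pinv:
  "(\<Sum>s\<in>label_stab l A. f (pinv s)) = (\<Sum>s\<in>label_stab l A. f s)"
  by (rule sum.reindex_bij_witness[where i = pinv and j = pinv])
    (auto intro: label_stab_pinv simp: permutes_inv_inv[OF label_stab_permutes])

lemma label_stab_const: "label_stab (\<lambda>_. c) A = {s. s permutes A}"
  by (simp add: label_stab_def)

text \<open>
  Every permutation of \<open>insert y Y\<close> is uniquely a permutation of \<open>Y\<close> followed by a transposition of
  \<open>y\<close> with its image, and it preserves labels exactly when both factors do.
\<close>

lemma sum_label_stab_insert:
  fixes f :: "(nat \<Rightarrow> nat) \<Rightarrow> 'a::comm_monoid_add"
  assumes Y: "finite Y" "y \<notin> Y"
  shows "sum f (label_stab l (insert y Y)) =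
    (\<Sum>b | b \<in> insert y Y \<and> l b = l y. \<Sum>q\<in>label_stab l Y. f (transpose y b \<circ> q))"
proof -
  define P where "P s \<longleftrightarrow> (\<forall>x. l (s x) = l x)" for s :: "nat \<Rightarrow> nat"
  have P: "P (transpose y b \<circ> q) \<longleftrightarrow> l b = l y \<and> P q" if "q permutes Y" for b q
  proof
    have qy: "q y = y" using that Y by (simp add: permutes_def)
    assume *: "P (transpose y b \<circ> q)"
    have lb: "l b = l y" using *[unfolded P_def, rule_format, of y] qy by simp
    hence "l (transpose y b x) = l x" for x by (auto simp: transpose_def)
    with * lb show "l b = l y \<and> P q" by (simp add: P_def)
  next
    assume *: "l b = l y \<and> P q"
    hence "l (transpose y b x) = l x" for x by (auto simp: transpose_def)
    with * show "P (transpose y b \<circ> q)" by (simp add: P_def)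
  qed
  have stab: "label_stab l A = {s \<in> {s. s permutes A}. P s}" for A
    by (auto simp: label_stab_def P_def)
  have "sum f (label_stab l (insert y Y)) = (\<Sum>s | s permutes insert y Y. if P s then f s else 0)"
    unfolding stab by (rule sum.inter_filter) (use Y in \<open>auto intro: finite_permutations\<close>)
  also have "\<dots> = (\<Sum>b\<in>insert y Y. \<Sum>q | q permutes Y.
      if P (transpose y b \<circ> q) then f (transpose y b \<circ> q) else 0)"
    by (rule sum_over_permutations_insert[OF Y])
  also have "\<dots> = (\<Sum>b\<in>insert y Y. if l b = l y then
      \<Sum>q | q permutes Y. if P q then f (transpose y b \<circ> q) else 0 else 0)"
    by (auto intro!: sum.cong simp: P)
  also have "\<dots> = (\<Sum>b\<in>insert y Y. if l b = l y then \<Sum>q\<in>label_stab l Y. f (transpose y b \<circ> q) else 0)"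
    unfolding stab using Y by (subst sum.inter_filter) (auto intro: finite_permutations)
  also have "\<dots> = (\<Sum>b | b \<in> insert y Y \<and> l b = l y. \<Sum>q\<in>label_stab l Y. f (transpose y b \<circ> q))"
    using Y by (subst sum.inter_filter[symmetric]) auto
  finally show ?thesis .
qed

section \<open>Sums of powers over cosets\<close>

text \<open>
  Adding a letter \<open>y\<close> multiplies the sum by a Jucys-Murphy factor: the identity coset contributes the
  old sum, and each of the other cosets contributes \<open>a\<close> times the old sum by \<open>nu_transpose_comp\<close>.
\<close>

lemma cycle_sum_insert:
  fixes a :: "'a::comm_semiring_1"
  assumes Y: "y \<notin> Y" "insert y Y \<subseteq> {..<N}"
  shows "(\<Sum>s\<in>label_stab l (insert y Y). a ^ nu N s) =
    (1 + of_nat (card {b\<in>Y. l b = l y}) * a) * (\<Sum>s\<in>label_stab l Y. a ^ nu N s)"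
    (is "?S (insert y Y) = _")
proof -
  have fin: "finite Y" using finite_subset[OF Y(2)] by simp
  have "(\<Sum>q\<in>label_stab l Y. a ^ nu N (transpose y b \<circ> q)) = a * ?S Y" if "b \<in> Y" for b
  proof -
    have "nu N (transpose y b \<circ> q) = Suc (nu N q)" if q: "q \<in> label_stab l Y" for q
    proof (rule nu_transpose_comp)
      from q have "q permutes Y" by (rule label_stab_permutes)
      thus "q permutes {..<N}" "q y = y" using Y by (auto intro: permutes_subset simp: permutes_def)
    qed (use Y \<open>b \<in> Y\<close> in auto)
    thus ?thesis by (simp add: sum_distrib_left)
  qed
  hence "(\<Sum>b\<in>{b\<in>Y. l b = l y}. \<Sum>q\<in>label_stab l Y. a ^ nu N (transpose y b \<circ> q)) =
      (\<Sum>b\<in>{b\<in>Y. l b = l y}. a * ?S Y)"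
    by (intro sum.cong) auto
  moreover have "{b. b \<in> insert y Y \<and> l b = l y} = insert y {b \<in> Y. l b = l y}" by auto
  ultimately have "?S (insert y Y) = ?S Y + (\<Sum>b\<in>{b\<in>Y. l b = l y}. a * ?S Y)"
    unfolding sum_label_stab_insert[OF fin Y(1)] using Y(1) fin by simp
  thus ?thesis by (simp add: distrib_right mult.assoc)
qed

lemma cycle_sum_initial:
  fixes a :: "'a::comm_semiring_1"
  assumes "m \<le> N"
  shows "(\<Sum>s\<in>label_stab l {..<m}. a ^ nu N s) = (\<Prod>y<m. 1 + of_nat (card {b. b < y \<and> l b = l y}) * a)"
  using assms
proof (induction m)
  case 0
  have "label_stab l {} = {id}" by (auto simp: label_stab_def)
  thus ?case by (simp del: id_apply)
next
  case (Suc m)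
  thus ?case
    using cycle_sum_insert[of m "{..<m}" N, where l = l and a = a]
    by (simp add: lessThan_Suc mult.commute)
qed

text \<open>
  This is \<open>1 (1 + a) (1 + 2 a) \<dots>\<close>, the generating function of the Stirling numbers of the first kind.
  At \<open>a = - 1 / k\<close> it vanishes as soon as \<open>X\<close> has more than \<open>k\<close> elements.
\<close>

lemma cycle_sum_permutes:
  fixes a :: "'a::comm_semiring_1"
  assumes "X \<subseteq> {..<N}"
  shows "(\<Sum>s | s permutes X. a ^ nu N s) = (\<Prod>i<card X. 1 + of_nat i * a)"
proof -
  have "finite X" using assms finite_subset by blast
  thus ?thesis using assms
  proof induction
    case empty
    thus ?case by (simp del: id_apply)
  next
    case (insert y X)
    thus ?case
      using cycle_sum_insert[of y X N, where l = "\<lambda>_. 0" and a = a]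
      by (simp add: label_stab_const mult.commute)
  qed
qed

text \<open>
  A coset of the symmetric group of \<open>X\<close> can be pulled back to that group one letter at a time: if \<open>g\<close>
  moves a letter \<open>y\<close> outside \<open>X\<close>, then \<open>g\<close> is a permutation fixing \<open>y\<close> followed by a transposition,
  which costs one factor \<open>a\<close> uniformly on the coset.
\<close>

lemma cycle_sum_coset_proportional:
  fixes a :: "'a::comm_semiring_1"
  assumes "finite Z" "X \<inter> Z = {}" "X \<union> Z \<subseteq> {..<N}" "g permutes (X \<union> Z)"
  shows "\<exists>c. (\<Sum>t | t permutes X. a ^ nu N (g \<circ> t)) = c * (\<Sum>t | t permutes X. a ^ nu N t)"
  using assms
proof (induction Z arbitrary: g)
  case empty
  hence "g \<in> label_stab (\<lambda>_. 0) X" by (simp add: label_stab_const)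
  from sum_label_stab_left[OF this, of "\<lambda>s. a ^ nu N s"] show ?case
    by (intro exI[of _ 1]) (simp add: label_stab_const del: o_apply)
next
  case (insert y Z)
  define h where "h = transpose y (g y) \<circ> g"
  have g: "g = transpose y (g y) \<circ> h"
    by (simp add: h_def fun_eq_iff)
  have h: "h permutes X \<union> Z"
    unfolding h_def by (rule permutes_insert_lemma) (use insert in simp)
  obtain c where c: "(\<Sum>t | t permutes X. a ^ nu N (h \<circ> t)) = c * (\<Sum>t | t permutes X. a ^ nu N t)"
    using insert.IH[OF _ _ h] insert.prems by (auto simp del: o_apply)
  show ?case
  proof (cases "g y = y")
    case True
    hence "g = h" using g by simp
    with c show ?thesis by blast
  next
    case False
    have gy: "g y < N"
      using insert.prems permutes_in_image[OF insert.prems(3), of y] by auto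
    have "nu N (g \<circ> t) = Suc (nu N (h \<circ> t))" if t: "t permutes X" for t
    proof -
      have ht: "h \<circ> t permutes X \<union> Z"
        by (intro permutes_compose h permutes_subset[OF t]) auto
      have "nu N (transpose y (g y) \<circ> (h \<circ> t)) = Suc (nu N (h \<circ> t))"
      proof (rule nu_transpose_comp)
        show "h \<circ> t permutes {..<N}" using permutes_subset[OF ht] insert.prems by auto
        show "(h \<circ> t) y = y" using ht insert by (simp add: permutes_def)
      qed (use gy False insert.prems in auto)
      thus ?thesis by (subst g) (simp add: o_assoc)
    qed
    hence "(\<Sum>t | t permutes X. a ^ nu N (g \<circ> t)) = a * (\<Sum>t | t permutes X. a ^ nu N (h \<circ> t))"
      by (simp add: sum_distrib_left)
    with c show ?thesis by (intro exI[of _ "a * c"]) (simp add: mult.assoc del: o_apply)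
  qed
qed

text \<open>
  The product for \<open>k + 1\<close> letters contains the factor \<open>1 - k / k\<close>. For matrices this means that the
  \<open>\<alpha>\<close>-determinant at \<open>\<alpha> = - 1 / k\<close> vanishes as soon as \<open>k + 1\<close> columns are equal.
\<close>

lemma cycle_sum_vanish:
  assumes "0 < k" "X \<subseteq> {..<N}" "card X = Suc k" "g permutes {..<N}"
  shows "(\<Sum>t | t permutes X. (- 1 / of_nat k) ^ nu N (g \<circ> t)) = (0::complex)"
proof -
  have "X \<union> ({..<N} - X) = {..<N}" using assms by auto
  then obtain c where "(\<Sum>t | t permutes X. (- 1 / of_nat k) ^ nu N (g \<circ> t)) =
      c * (\<Sum>t | t permutes X. (- 1 / of_nat k :: complex) ^ nu N t)"
    using cycle_sum_coset_proportional[of "{..<N} - X" X N g "- 1 / of_nat k :: complex"] assms by auto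
  also have "(\<Sum>t | t permutes X. (- 1 / of_nat k :: complex) ^ nu N t) = 0"
    unfolding cycle_sum_permutes[OF assms(2)] assms(3) using assms(1) by simp
  finally show ?thesis by (simp del: o_apply)
qed

section \<open>Uniqueness of the spherical function\<close>

text \<open>
  The two-sided invariance makes \<open>u g\<close> a function of the contingency table counting the \<open>x\<close> with
  \<open>l x = j\<close> and \<open>l (g x) = i\<close>, and the vanishing of symmetrizations is a Garnir relation with which
  every table can be straightened to the diagonal one, that is to \<open>g\<close> in \<open>H\<close>. The measure is the
  number of letters whose label is kept by \<open>g\<close>. If some \<open>y\<close> has \<open>l (g y) \<noteq> l y\<close>, symmetrize over \<open>y\<close>
  and the fibre \<open>B\<close> of the label \<open>l (g y)\<close>. This gives that the sum of \<open>u (g \<circ> transpose y b)\<close> over \<open>b\<close>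
  in \<open>insert y B\<close> is zero. Each term either has the same table as \<open>g\<close>, or keeps more labels and
  vanishes by induction; so a positive multiple of \<open>u g\<close> is zero.
\<close>

lemma spherical_function_zero:
  fixes u :: "(nat \<Rightarrow> nat) \<Rightarrow> 'a::field_char_0" and l :: "nat \<Rightarrow> nat" and N k :: nat
  defines "H \<equiv> label_stab l {..<N}"
  assumes fibre: "\<And>y. y < N \<Longrightarrow> card {x. x < N \<and> l x = l y} = k"
    and right: "\<And>g h. g permutes {..<N} \<Longrightarrow> h \<in> H \<Longrightarrow> u (g \<circ> h) = u g"
    and left: "\<And>g h. g permutes {..<N} \<Longrightarrow> h \<in> H \<Longrightarrow> u (h \<circ> g) = u g"
    and vanish: "\<And>g X. g permutes {..<N} \<Longrightarrow> X \<subseteq> {..<N} \<Longrightarrow> card X = Suc k \<Longrightarrow>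
      (\<Sum>t | t permutes X. u (g \<circ> t)) = 0"
    and zero: "u id = 0"
    and g: "g permutes {..<N}"
  shows "u g = 0"
  using g
proof (induction "N - card {x. x < N \<and> l (g x) = l x}" arbitrary: g rule: less_induct)
  case (less g)
  show ?case
  proof (cases "\<forall>x<N. l (g x) = l x")
    case True
    have "g \<in> H"
      unfolding H_def label_stab_def using less.prems True
      by (auto simp: permutes_def)
    from right[OF permutes_id this] zero show ?thesis by simp
  next
    case False
    then obtain y where y: "y < N" "l (g y) \<noteq> l y" by blast
    have gy: "g y < N" using permutes_in_image[OF less.prems, of y] y by simp
    define B where "B = {x. x < N \<and> l x = l (g y)}"
    have fin: "finite B" by (simp add: B_def)
    have yB: "y \<notin> B" using y by (simp add: B_def)
    have BN: "b < N" "l b = l (g y)" if "b \<in> B" for b using that by (auto simp: B_def)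
    have card_B: "card (insert y B) = Suc k"
      using fibre[OF gy] fin yB by (simp add: B_def)
    have swap: "g \<circ> transpose y b permutes {..<N}" if "b \<in> insert y B" for b
      by (intro permutes_compose less.prems permutes_swap_id) (use y BN that in auto)
    have B_perm: "q \<in> H" if "q permutes B" for q
    proof -
      have "l (q x) = l x" for x
        using permutes_in_image[OF that, of x] permutes_not_in[OF that, of x] by (cases "x \<in> B") (auto simp: B_def)
      moreover have "q permutes {..<N}" by (rule permutes_subset[OF that]) (use BN in auto)
      ultimately show ?thesis by (simp add: H_def label_stab_def)
    qed
    \<comment> \<open>The symmetrization splits into cosets of the symmetric group of \<open>B\<close>, which lies in \<open>H\<close>.\<close>
    have "0 = (\<Sum>t | t permutes insert y B. u (g \<circ> t))"
      using vanish[OF less.prems _ card_B] y BN by auto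
    also have "\<dots> = (\<Sum>b\<in>insert y B. \<Sum>q | q permutes B. u (g \<circ> (transpose y b \<circ> q)))"
      by (rule sum_over_permutations_insert[OF fin yB])
    also have "\<dots> = (\<Sum>b\<in>insert y B. \<Sum>q | q permutes B. u (g \<circ> transpose y b))"
      by (intro sum.cong refl) (use right[OF swap B_perm] in \<open>simp add: o_assoc\<close>)
    also have "\<dots> = fact (card B) * (\<Sum>b\<in>insert y B. u (g \<circ> transpose y b))"
      using card_permutations[OF refl fin] by (simp add: sum_distrib_left del: sum.insert)
    finally have "(\<Sum>b\<in>insert y B. u (g \<circ> transpose y b)) = 0" by simp
    hence sum0: "u g + (\<Sum>b\<in>B. u (g \<circ> transpose y b)) = 0"
      using fin yB by simp
    have "u (g \<circ> transpose y b) = (if l (g b) = l (g y) then u g else 0)" if b: "b \<in> B" for b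
    proof (cases "l (g b) = l (g y)")
      case True
      have "g b < N" using permutes_in_image[OF less.prems, of b] BN[OF b] by simp
      hence "transpose (g y) (g b) permutes {..<N}" using gy by (intro permutes_swap_id) auto
      moreover have "l (transpose (g y) (g b) x) = l x" for x using True by (auto simp: transpose_def)
      ultimately have "transpose (g y) (g b) \<in> H" by (simp add: H_def label_stab_def)
      moreover have "g \<circ> transpose y b = transpose (g y) (g b) \<circ> g"
        using permutes_inj[OF less.prems] by (auto simp: fun_eq_iff transpose_def dest: injD)
      ultimately show ?thesis using True left[OF less.prems] by simp
    next
      case False
      define g' where "g' = g \<circ> transpose y b"
      have yb: "y \<noteq> b" using yB b by blast
      have g'v: "g' x = (if x = y then g b else if x = b then g y else g x)" for x
        by (simp add: g'_def transpose_def)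
      \<comment> \<open>The swap puts \<open>g y\<close>, whose label is that of \<open>b\<close>, at \<open>b\<close>; neither \<open>y\<close> nor \<open>b\<close> kept its label before.\<close>
      have "{x. x < N \<and> l (g x) = l x} \<subset> {x. x < N \<and> l (g' x) = l x}"
      proof
        show "{x. x < N \<and> l (g x) = l x} \<subseteq> {x. x < N \<and> l (g' x) = l x}"
          using y BN[OF b] False by (auto simp: g'v)
        have "b \<in> {x. x < N \<and> l (g' x) = l x}" "b \<notin> {x. x < N \<and> l (g x) = l x}"
          using BN[OF b] False yb by (auto simp: g'v)
        thus "{x. x < N \<and> l (g x) = l x} \<noteq> {x. x < N \<and> l (g' x) = l x}" by blast
      qed
      hence "card {x. x < N \<and> l (g x) = l x} < card {x. x < N \<and> l (g' x) = l x}"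
        by (intro psubset_card_mono) auto
      moreover have "card {x. x < N \<and> l (g' x) = l x} \<le> N"
        using card_mono[of "{..<N}" "{x. x < N \<and> l (g' x) = l x}"] by auto
      ultimately have "u g' = 0"
        using swap[of b] b by (intro less.hyps) (auto simp: g'_def)
      thus ?thesis using False by (simp add: g'_def)
    qed
    hence "(\<Sum>b\<in>B. u (g \<circ> transpose y b)) = of_nat (card {b\<in>B. l (g b) = l (g y)}) * u g"
      using fin by (simp flip: sum.inter_filter)
    with sum0 have "of_nat (Suc (card {b\<in>B. l (g b) = l (g y)})) * u g = 0"
      by (simp add: distrib_right)
    thus ?thesis by (metis mult_eq_0_iff of_nat_eq_0_iff nat.distinct(2))
  qed
qed

section \<open>The two spherical functions\<close>

text \<open>
  With \<open>l x = x div k\<close>, \<open>N = k * n\<close> and \<open>a = - 1 / k\<close> this is \<open>wrdet k (perm_mat N g * rep_id_mat n k)\<close>.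
\<close>

definition cycle_coset_sum :: "(nat \<Rightarrow> nat) \<Rightarrow> nat \<Rightarrow> complex \<Rightarrow> (nat \<Rightarrow> nat) \<Rightarrow> complex" where
  "cycle_coset_sum l N a g = (\<Sum>h\<in>label_stab l {..<N}. a ^ nu N (g \<circ> h))"

lemma cycle_coset_sum_right:
  assumes "h \<in> label_stab l {..<N}"
  shows "cycle_coset_sum l N a (g \<circ> h) = cycle_coset_sum l N a g"
  using sum_label_stab_left[OF assms, of "\<lambda>s. a ^ nu N (g \<circ> s)"]
  by (simp add: cycle_coset_sum_def o_assoc)

lemma cycle_coset_sum_left:
  assumes "g permutes {..<N}" and h: "h \<in> label_stab l {..<N}"
  shows "cycle_coset_sum l N a (h \<circ> g) = cycle_coset_sum l N a g"
proof -
  have "nu N (h \<circ> g \<circ> s) = nu N (g \<circ> (s \<circ> h))" if "s \<in> label_stab l {..<N}" for s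
    using nu_comp_commute[of h N "g \<circ> s"] assms that
    by (simp add: o_assoc permutes_compose label_stab_permutes)
  thus ?thesis
    using sum_label_stab_right[OF h, of "\<lambda>s. a ^ nu N (g \<circ> s)"]
    by (simp add: cycle_coset_sum_def)
qed

lemma cycle_coset_sum_vanish:
  assumes "0 < k" "g permutes {..<N}" "X \<subseteq> {..<N}" "card X = Suc k"
  shows "(\<Sum>t | t permutes X. cycle_coset_sum l N (- 1 / of_nat k) (g \<circ> t)) = 0"
proof -
  let ?a = "- 1 / of_nat k :: complex"
  have "(\<Sum>t | t permutes X. cycle_coset_sum l N ?a (g \<circ> t)) =
      (\<Sum>h\<in>label_stab l {..<N}. \<Sum>t | t permutes X. ?a ^ nu N (g \<circ> t \<circ> h))"
    unfolding cycle_coset_sum_def by (rule sum.swap)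
  also have "\<dots> = (\<Sum>h\<in>label_stab l {..<N}. \<Sum>t | t permutes X. ?a ^ nu N ((h \<circ> g) \<circ> t))"
  proof (intro sum.cong refl)
    fix h t assume "h \<in> label_stab l {..<N}" "t \<in> {t. t permutes X}"
    hence "h permutes {..<N}" "t permutes {..<N}"
      using assms by (auto intro: label_stab_permutes permutes_subset)
    hence "nu N (g \<circ> t \<circ> h) = nu N (h \<circ> (g \<circ> t))"
      using assms by (intro nu_comp_commute permutes_compose)
    thus "?a ^ nu N (g \<circ> t \<circ> h) = ?a ^ nu N ((h \<circ> g) \<circ> t)" by (simp add: o_assoc)
  qed
  also have "\<dots> = 0"
    by (rule sum.neutral) (use assms in \<open>blast intro: cycle_sum_vanish permutes_compose label_stab_permutes\<close>)
  finally show ?thesis .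
qed

text \<open>
  Listing the letters in increasing order turns the sum over the label group into the product of the
  factors of \<open>cycle_sum_insert\<close>. Taking \<open>a = 1\<close> gives the order of the group.
\<close>

lemma cycle_coset_sum_id:
  "cycle_coset_sum l N a id = (\<Prod>y<N. 1 + of_nat (card {b. b < y \<and> l b = l y}) * a)"
  using cycle_sum_initial[of N N] by (simp add: cycle_coset_sum_def)

text \<open>
  The coefficient function of the column antisymmetrizer, \<open>c x\<close> being the column of \<open>x\<close>.
\<close>

definition col_sign :: "(nat \<Rightarrow> nat) \<Rightarrow> nat \<Rightarrow> (nat \<Rightarrow> nat) \<Rightarrow> complex" where
  "col_sign c N s = (if s \<in> label_stab c {..<N} then of_int (sign s) else 0)"

lemma col_sign_transpose:
  assumes s: "s permutes {..<N}" and pq: "p < N" "q < N" "p \<noteq> q" "c p = c q"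
  shows "col_sign c N (s \<circ> transpose p q) = - col_sign c N s"
proof -
  have tr: "transpose p q \<in> label_stab c {..<N}"
    using pq by (auto simp: label_stab_def transpose_def intro!: permutes_swap_id)
  have "s \<circ> transpose p q \<in> label_stab c {..<N} \<longleftrightarrow> s \<in> label_stab c {..<N}"
    using label_stab_comp[OF _ tr, of s] label_stab_comp[OF _ tr, of "s \<circ> transpose p q"]
    by (auto simp: comp_assoc)
  moreover have "permutation s" using s by (auto simp: permutation_permutes)
  hence "sign (s \<circ> transpose p q) = - sign s"
    using pq by (simp add: sign_compose sign_swap_id permutation_swap_id)
  ultimately show ?thesis by (simp add: col_sign_def)
qed

text \<open>
  Pigeonhole: among \<open>k + 1\<close> letters two lie in the same one of the \<open>k\<close> columns. Their transposition
  can be absorbed into the symmetrization on one side and changes the sign on the other.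
\<close>

lemma col_sign_vanish:
  assumes "r permutes {..<N}" "s permutes {..<N}" "X \<subseteq> {..<N}" "c ` {..<N} \<subseteq> {..<k}" "card X = Suc k"
  shows "(\<Sum>t | t permutes X. col_sign c N (r \<circ> t \<circ> s)) = 0"
proof -
  have "card (c ` pinv s ` X) \<le> k"
  proof -
    have "pinv s ` X \<subseteq> {..<N}"
      using permutes_image[OF permutes_inv[OF assms(2)]] assms(3) by blast
    hence "c ` pinv s ` X \<subseteq> {..<k}" using assms(4) by blast
    thus ?thesis using card_mono[of "{..<k}"] by fastforce
  qed
  moreover have "inj_on (pinv s) X"
    using permutes_inj[OF permutes_inv[OF assms(2)]] by (rule inj_on_subset) simp
  hence "card (pinv s ` X) = Suc k" using assms(5) by (simp add: card_image)
  ultimately have "\<not> inj_on c (pinv s ` X)" by (auto dest: card_image)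
  then obtain x y where xy: "x \<in> X" "y \<in> X" "pinv s x \<noteq> pinv s y" "c (pinv s x) = c (pinv s y)"
    by (auto simp: inj_on_def)
  have N: "pinv s x < N" "pinv s y < N"
    using xy(1,2) assms(3) permutes_in_image[OF permutes_inv[OF assms(2)]] by blast+
  have tr: "transpose x y \<in> label_stab (\<lambda>_. 0) X"
    using xy by (auto simp: label_stab_const intro!: permutes_swap_id)
  have conj: "transpose x y \<circ> s = s \<circ> transpose (pinv s x) (pinv s y)"
    using permutes_inverses[OF assms(2)] by (auto simp: fun_eq_iff transpose_def)
  let ?S = "\<Sum>t | t permutes X. col_sign c N (r \<circ> t \<circ> s)"
  have "?S = (\<Sum>t | t permutes X. col_sign c N (r \<circ> (t \<circ> transpose x y) \<circ> s))"
    using sum_label_stab_right[OF tr, of "\<lambda>t. col_sign c N (r \<circ> t \<circ> s)"]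
    by (simp add: label_stab_const)
  also have "\<dots> = (\<Sum>t | t permutes X. - col_sign c N (r \<circ> t \<circ> s))"
  proof (intro sum.cong refl)
    fix t assume "t \<in> {t. t permutes X}"
    hence "r \<circ> t \<circ> s permutes {..<N}"
      using assms by (intro permutes_compose) (auto intro: permutes_subset)
    from col_sign_transpose[where c = c, OF this N xy(3,4)]
    show "col_sign c N (r \<circ> (t \<circ> transpose x y) \<circ> s) = - col_sign c N (r \<circ> t \<circ> s)"
      by (simp add: comp_assoc conj)
  qed
  also have "\<dots> = - ?S" by (rule sum_negf)
  finally show ?thesis by simp
qed

text \<open>
  The coefficient function of the Young symmetrizer. The summation variable \<open>h\<close> is the inverse of the
  row permutation in the factorization of \<open>s\<close> as a row permutation times a column permutation.
\<close>

definition row_col_sum :: "(nat \<Rightarrow> nat) \<Rightarrow> (nat \<Rightarrow> nat) \<Rightarrow> nat \<Rightarrow> (nat \<Rightarrow> nat) \<Rightarrow> complex" where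
  "row_col_sum l c N s = (\<Sum>h\<in>label_stab l {..<N}. col_sign c N (h \<circ> s))"

lemma row_col_sum_left:
  assumes "h \<in> label_stab l {..<N}"
  shows "row_col_sum l c N (h \<circ> s) = row_col_sum l c N s"
  using sum_label_stab_right[OF assms, of "\<lambda>h. col_sign c N (h \<circ> s)"]
  by (simp add: row_col_sum_def o_assoc)

lemma row_col_sum_vanish:
  assumes "s permutes {..<N}" "X \<subseteq> {..<N}" "c ` {..<N} \<subseteq> {..<k}" "card X = Suc k"
  shows "(\<Sum>t | t permutes X. row_col_sum l c N (t \<circ> s)) = 0"
proof -
  have "(\<Sum>t | t permutes X. row_col_sum l c N (t \<circ> s)) =
      (\<Sum>h\<in>label_stab l {..<N}. \<Sum>t | t permutes X. col_sign c N (h \<circ> (t \<circ> s)))"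
    unfolding row_col_sum_def by (rule sum.swap)
  also have "\<dots> = 0"
    unfolding o_assoc
    by (rule sum.neutral) (use assms in \<open>blast intro: col_sign_vanish label_stab_permutes\<close>)
  finally show ?thesis .
qed

text \<open>
  Rows and columns meet in at most one letter, so only the identity preserves both.
\<close>

lemma row_col_sum_id:
  assumes "inj_on (\<lambda>x. (l x, c x)) {..<N}"
  shows "row_col_sum l c N id = 1"
proof -
  have "h = id" if h: "h \<in> label_stab l {..<N}" "h \<in> label_stab c {..<N}" for h
  proof
    fix x
    have p: "h permutes {..<N}" using h(1) by (rule label_stab_permutes)
    show "h x = id x"
    proof (cases "x < N")
      case True
      hence "h x < N" using permutes_in_image[OF p, of x] by simp
      moreover have "l (h x) = l x" "c (h x) = c x" using h by (simp_all add: label_stab_def)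
      ultimately show ?thesis using inj_onD[OF assms, of "h x" x] True by simp
    qed (use permutes_not_in[OF p] in simp)
  qed
  hence "row_col_sum l c N id = (\<Sum>h\<in>label_stab l {..<N}. if h = id then 1 else 0)"
    unfolding row_col_sum_def by (intro sum.cong refl) (auto simp: col_sign_def sign_id id_in_label_stab)
  also have "\<dots> = 1" by (simp add: finite_label_stab id_in_label_stab)
  finally show ?thesis .
qed

text \<open>
  In the group algebra, with \<open>a\<close> the sum of the row group \<open>H\<close> and \<open>e\<close> the Young symmetrizer, the left
  side is the coefficient of \<open>s\<close> in \<open>a g e\<close>; the statement says that \<open>a g e\<close> is the multiple of \<open>e\<close> with
  factor \<open>card H * W g / W id\<close>. For fixed \<open>s\<close>, both that coefficient and \<open>W\<close> are invariant under \<open>H\<close> on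
  either side and vanish when symmetrized over \<open>k + 1\<close> letters, so \<open>spherical_function_zero\<close>
  applies to the combination of the two that is zero at the identity.
\<close>

lemma row_average_row_col_sum:
  fixes l c :: "nat \<Rightarrow> nat" and N k :: nat
  defines "H \<equiv> label_stab l {..<N}"
    and "W \<equiv> cycle_coset_sum l N (- 1 / of_nat k)"
  assumes k: "0 < k" and fibre: "\<And>y. y < N \<Longrightarrow> card {x. x < N \<and> l x = l y} = k"
    and c: "c ` {..<N} \<subseteq> {..<k}" and W: "W id \<noteq> 0"
    and g: "g permutes {..<N}" and s: "s permutes {..<N}"
  shows "(\<Sum>h\<in>H. row_col_sum l c N (pinv g \<circ> h \<circ> s)) = of_nat (card H) * W g / W id * row_col_sum l c N s"
proof -
  let ?e = "row_col_sum l c N"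
  define A where "A g = (\<Sum>h\<in>H. ?e (pinv g \<circ> h \<circ> s))" for g
  have A_id: "A id = of_nat (card H) * ?e s"
    unfolding A_def by (simp add: row_col_sum_left H_def)
  have pinv_comp: "pinv (g \<circ> h) = pinv h \<circ> pinv g" if "g permutes {..<N}" "h permutes {..<N}" for g h
    using that by (intro o_inv_distrib permutes_bij)
  define u where "u g = W id * A g - A id * W g" for g
  have "u g = 0"
  proof (rule spherical_function_zero[where u = u and l = l and N = N and k = k and g = g])
    show "u id = 0" by (simp add: u_def)
    fix g assume g: "g permutes {..<N}"
    {
      fix h assume h: "h \<in> label_stab l {..<N}"
      note h' = label_stab_permutes[OF h]
      have "A (g \<circ> h) = A g"
        unfolding A_def pinv_comp[OF g h'] comp_assoc
        by (simp add: row_col_sum_left[OF label_stab_pinv[OF h]])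
      thus "u (g \<circ> h) = u g"
        unfolding u_def W_def by (simp add: cycle_coset_sum_right[OF h])
      have "A (h \<circ> g) = A g"
        unfolding A_def pinv_comp[OF h' g] H_def
        using sum_label_stab_left[OF label_stab_pinv[OF h], of "\<lambda>h. ?e (pinv g \<circ> h \<circ> s)"]
        by (simp add: comp_assoc)
      thus "u (h \<circ> g) = u g"
        unfolding u_def W_def by (simp add: cycle_coset_sum_left[OF g h])
    }
    fix X assume X: "X \<subseteq> {..<N}" "card X = Suc k"
    have "(\<Sum>t | t permutes X. A (g \<circ> t)) = (\<Sum>h\<in>H. \<Sum>t | t permutes X. ?e (pinv (g \<circ> t) \<circ> h \<circ> s))"
      unfolding A_def by (rule sum.swap)
    also have "\<dots> = (\<Sum>h\<in>H. 0)"
    proof (intro sum.cong refl)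
      fix h assume h: "h \<in> H"
      have "(\<Sum>t | t permutes X. ?e (pinv (g \<circ> t) \<circ> h \<circ> s)) =
          (\<Sum>t | t permutes X. ?e (pinv t \<circ> (pinv g \<circ> h \<circ> s)))"
        using X by (intro sum.cong refl) (auto simp: pinv_comp[OF g permutes_subset] comp_assoc)
      also have "\<dots> = (\<Sum>t | t permutes X. ?e (t \<circ> (pinv g \<circ> h \<circ> s)))"
        by (rule sum_permutations_inverse[symmetric])
      also have "\<dots> = 0"
        using X c g s label_stab_permutes[OF h[unfolded H_def]]
        by (intro row_col_sum_vanish permutes_compose permutes_inv)
      finally show "(\<Sum>t | t permutes X. ?e (pinv (g \<circ> t) \<circ> h \<circ> s)) = 0" .
    qed
    finally have "(\<Sum>t | t permutes X. A (g \<circ> t)) = 0" by simp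
    thus "(\<Sum>t | t permutes X. u (g \<circ> t)) = 0"
      using cycle_coset_sum_vanish[OF k g X, of l]
      by (simp add: u_def W_def sum_subtractf flip: sum_distrib_left)
  qed (use fibre g in blast)+
  thus ?thesis
    using W by (simp add: u_def A_id field_simps flip: A_def)
qed
section \<open>Traces of rank one sums on left ideals\<close>

text \<open>
  The sum of the operators \<open>T i\<close> is the rank one operator that sends \<open>x\<close> to \<open>f x\<close> times \<open>v\<close>; its trace is
  \<open>f v\<close> in every basis. Adding the traces is legitimate because \<open>trace_on\<close> picks the same basis of \<open>W\<close>
  for all of them. A finite spanning set guarantees that this basis is finite, as otherwise the sums
  over it would be zero by convention.
\<close>

lemma trace_on_sum_rank_one:
  assumes S: "finite S" "W = galg.span S" and v: "v \<in> W"
    and f: "additive f" "\<And>c x. f (galg_scale c x) = c * f x"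
    and T: "\<And>i x. i \<in> I \<Longrightarrow> x \<in> W \<Longrightarrow> T i x \<in> W"
    and rank1: "\<And>x. x \<in> W \<Longrightarrow> (\<Sum>i\<in>I. T i x) = galg_scale (f x) v"
  shows "(\<Sum>i\<in>I. trace_on W (T i)) = f v"
proof -
  define B where "B = (SOME B. galg.independent B \<and> galg.span B = W)"
  have "\<exists>B. galg.independent B \<and> galg.span B = W"
  proof -
    obtain B where B: "B \<subseteq> W" "galg.independent B" "W \<subseteq> galg.span B"
      using galg.maximal_independent_subset by blast
    have "galg.span B \<subseteq> W"
      unfolding S(2) using B(1) by (intro galg.span_minimal galg.subspace_span) (simp add: S(2))
    with B show ?thesis by blast
  qed
  hence "galg.independent B \<and> galg.span B = W" unfolding B_def by (rule someI_ex)
  hence B: "galg.independent B" "galg.span B = W" by auto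
  have BW: "b \<in> W" if "b \<in> B" for b using that galg.span_base B(2) by blast
  have fin: "finite B"
    using galg.independent_span_bound[OF S(1) B(1)] galg.span_superset B(2) S(2) by blast
  have "(\<Sum>i\<in>I. trace_on W (T i)) = (\<Sum>i\<in>I. \<Sum>b\<in>B. galg.representation B (T i b) b)"
    by (simp add: trace_on_def Let_def flip: B_def)
  also have "\<dots> = (\<Sum>b\<in>B. \<Sum>i\<in>I. galg.representation B (T i b) b)"
    by (rule sum.swap)
  also have "\<dots> = (\<Sum>b\<in>B. f b * galg.representation B v b)"
  proof (rule sum.cong[OF refl])
    fix b assume b: "b \<in> B"
    have "(\<Sum>i\<in>I. galg.representation B (T i b) b) = galg.representation B (\<Sum>i\<in>I. T i b) b"
      by (subst galg.representation_sum[OF B(1)]) (use T BW[OF b] B(2) in auto)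
    also have "\<dots> = f b * galg.representation B v b"
      using rank1[OF BW[OF b]] v B by (simp add: galg.representation_scale)
    finally show "(\<Sum>i\<in>I. galg.representation B (T i b) b) = f b * galg.representation B v b" .
  qed
  also have "\<dots> = f (\<Sum>b\<in>B. galg_scale (galg.representation B v b) b)"
    by (simp add: additive.sum[OF f(1)] f(2) mult.commute)
  also have "(\<Sum>b\<in>B. galg_scale (galg.representation B v b) b) = v"
    using galg.sum_representation_eq[OF B(1) _ fin] v B(2) by auto
  finally show ?thesis .
qed

lemma galg_sum_apply: "(sum f A) s = (\<Sum>a\<in>A. f a s)" for f :: "'b \<Rightarrow> galg"
  by (induction A rule: infinite_finite_induct) auto

lemma finite_symgrp: "finite (symgrp N)"
  by (simp add: symgrp_def finite_permutations)

lemma galg_mult_basis: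
  assumes "g \<in> symgrp N"
  shows "galg_mult N (galg_basis g) x s = (if s \<in> symgrp N then x (pinv g \<circ> s) else 0)"
proof -
  have "(\<Sum>h\<in>symgrp N. galg_basis g h * x (pinv h \<circ> s)) =
      (\<Sum>h\<in>symgrp N. if h = g then x (pinv h \<circ> s) else 0)"
    by (intro sum.cong refl) (simp add: galg_basis_def)
  also have "\<dots> = x (pinv g \<circ> s)" using assms finite_symgrp by (simp add: sum.delta)
  finally show ?thesis by (simp add: galg_mult_def)
qed

lemma galg_mult_expand:
  "galg_mult N x y = (\<Sum>h\<in>symgrp N. galg_scale (x h) (galg_mult N (galg_basis h) y))"
  by (rule ext) (simp add: galg_sum_apply galg_scale_def galg_mult_basis, simp add: galg_mult_def)

lemma left_ideal_span:
  "{galg_mult N x y | x. x \<in> galg_carrier N} = galg.span ((\<lambda>h. galg_mult N (galg_basis h) y) ` symgrp N)"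
  (is "?L = galg.span ?S")
proof
  show "?L \<subseteq> galg.span ?S"
  proof
    fix z assume "z \<in> ?L"
    then obtain x where "z = galg_mult N x y" by blast
    hence z: "z = (\<Sum>h\<in>symgrp N. galg_scale (x h) (galg_mult N (galg_basis h) y))"
      by (simp only: galg_mult_expand[of N x y])
    show "z \<in> galg.span ?S"
      unfolding z by (rule galg.span_sum, rule galg.span_scale, rule galg.span_base) (rule imageI)
  qed
  have "?S \<subseteq> ?L"
    by (auto simp: galg_carrier_def galg_basis_def)
  moreover have "galg.subspace ?L"
  proof (rule galg.subspaceI)
    have "0 = galg_mult N 0 y" by (auto simp: galg_mult_def)
    thus "0 \<in> ?L" by (auto simp: galg_carrier_def)
  next
    fix a b assume "a \<in> ?L" "b \<in> ?L"
    then obtain x z where "a = galg_mult N x y" "b = galg_mult N z y" and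
      xz: "x \<in> galg_carrier N" "z \<in> galg_carrier N" by blast
    hence "a + b = galg_mult N (x + z) y"
      by (auto simp: galg_mult_def fun_eq_iff algebra_simps sum.distrib)
    moreover have "x + z \<in> galg_carrier N" using xz by (auto simp: galg_carrier_def)
    ultimately show "a + b \<in> ?L" by blast
  next
    fix c a assume "a \<in> ?L"
    then obtain x where "a = galg_mult N x y" and x: "x \<in> galg_carrier N" by blast
    hence "galg_scale c a = galg_mult N (galg_scale c x) y"
      by (auto simp: galg_mult_def galg_scale_def fun_eq_iff sum_distrib_left algebra_simps)
    moreover have "galg_scale c x \<in> galg_carrier N" using x by (auto simp: galg_carrier_def galg_scale_def)
    ultimately show "galg_scale c a \<in> ?L" by blast
  qed
  ultimately show "galg.span ?S \<subseteq> ?L" by (rule galg.span_minimal)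
qed

text \<open>
  Associativity of the product when the first factor is a group element; it makes left ideals
  invariant under the group.
\<close>

lemma galg_mult_assoc_basis:
  assumes "g \<in> symgrp N"
  shows "galg_mult N (galg_basis g) (galg_mult N x y) = galg_mult N (\<lambda>s. x (pinv g \<circ> s)) y"
proof (rule ext)
  fix s
  have g: "g permutes {..<N}" using assms by (simp add: symgrp_def)
  show "galg_mult N (galg_basis g) (galg_mult N x y) s = galg_mult N (\<lambda>s. x (pinv g \<circ> s)) y s"
  proof (cases "s \<in> symgrp N")
    case True
    hence s: "s permutes {..<N}" by (simp add: symgrp_def)
    have "(\<Sum>h\<in>symgrp N. x h * y (pinv h \<circ> (pinv g \<circ> s))) =
        (\<Sum>h\<in>symgrp N. x (pinv g \<circ> h) * y (pinv h \<circ> s))"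
    proof (rule sum.reindex_bij_witness[where i = "\<lambda>h. pinv g \<circ> h" and j = "\<lambda>h. g \<circ> h"])
      fix h assume "h \<in> symgrp N"
      hence h: "h permutes {..<N}" by (simp add: symgrp_def)
      show "pinv g \<circ> (g \<circ> h) = h" "g \<circ> (pinv g \<circ> h) = h"
        using pinv_o[OF g] by auto
      show "g \<circ> h \<in> symgrp N" "pinv g \<circ> h \<in> symgrp N"
        using g h by (auto simp: symgrp_def intro: permutes_compose permutes_inv)
      have "pinv (g \<circ> h) = pinv h \<circ> pinv g"
        using g h by (intro o_inv_distrib permutes_bij)
      thus "x (pinv g \<circ> (g \<circ> h)) * y (pinv (g \<circ> h) \<circ> s) = x h * y (pinv h \<circ> (pinv g \<circ> s))"
        using pinv_o[OF g] by (simp add: comp_assoc)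
    qed
    moreover have "pinv g \<circ> s \<in> symgrp N"
      using g s by (auto simp: symgrp_def intro: permutes_compose permutes_inv)
    ultimately show ?thesis
      using True unfolding galg_mult_basis[OF assms] by (simp add: galg_mult_def)
  qed (use assms in \<open>simp add: galg_mult_basis galg_mult_def\<close>)
qed

section \<open>Rectangular diagrams\<close>

lemma sum_list_take_replicate: "i \<le> n \<Longrightarrow> sum_list (take i (replicate n k)) = k * (i :: nat)"
  by (simp add: sum_list_replicate min_def)

lemma div_eq_atLeastLessThan:
  fixes k i :: nat
  assumes "0 < k"
  shows "{x. x div k = i} = {k * i..<k * Suc i}"
  using assms by (auto simp: div_nat_eqI mult.commute dividend_less_times_div)

lemma block_replicate:
  assumes "i < n" "0 < k"
  shows "block (replicate n k) i = {x. x div k = i}"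
  unfolding block_def div_eq_atLeastLessThan[OF assms(2)]
  using assms sum_list_take_replicate[of i n k] sum_list_take_replicate[of "Suc i" n k] by simp

lemma young_subgroup_replicate:
  assumes "0 < k"
  shows "young_subgroup (replicate n k) = label_stab (\<lambda>x. x div k) {..<k * n}"
proof (rule equalityI; rule subsetI)
  fix t assume "t \<in> young_subgroup (replicate n k)"
  hence t: "t permutes {..<k * n}" and im: "\<And>i. i < n \<Longrightarrow> t ` {x. x div k = i} = {x. x div k = i}"
    using assms by (auto simp: young_subgroup_def symgrp_def block_replicate sum_list_replicate mult.commute)
  have "t x div k = x div k" for x
  proof (cases "x < k * n")
    case True
    hence "x div k < n" by (simp add: less_mult_imp_div_less mult.commute)
    from im[OF this] show ?thesis by blast
  qed (use permutes_not_in[OF t] in simp)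
  with t show "t \<in> label_stab (\<lambda>x. x div k) {..<k * n}" by (simp add: label_stab_def)
next
  fix t assume "t \<in> label_stab (\<lambda>x. x div k) {..<k * n}"
  hence t: "t permutes {..<k * n}" and im: "\<And>x. t x div k = x div k" by (auto simp: label_stab_def)
  have "t ` {x. x div k = i} = {x. x div k = i}" for i
  proof
    show "{x. x div k = i} \<subseteq> t ` {x. x div k = i}"
    proof
      fix x assume "x \<in> {x. x div k = i}"
      hence "pinv t x \<in> {x. x div k = i}" "t (pinv t x) = x"
        using im[of "pinv t x"] permutes_inverses(1)[OF t, of x] by auto
      thus "x \<in> t ` {x. x div k = i}" by (metis imageI)
    qed
  qed (use im in auto)
  thus "t \<in> young_subgroup (replicate n k)"
    using t assms by (auto simp: young_subgroup_def symgrp_def block_replicate sum_list_replicate mult.commute)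
qed

lemma tab_col_replicate:
  assumes "x < k * n"
  shows "tab_col (replicate n k) x = x mod k"
proof -
  have k: "0 < k" using assms by (cases k) auto
  have xn: "x div k < n" using assms by (simp add: less_mult_imp_div_less mult.commute)
  have "tab_row (replicate n k) x = x div k"
    unfolding tab_row_def using k xn by (intro the_equality) (auto simp: block_replicate)
  thus ?thesis
    using sum_list_take_replicate[of "x div k" n k] xn by (simp add: tab_col_def minus_mult_div_eq_mod)
qed

lemma column_stabilizer_replicate:
  "column_stabilizer (replicate n k) = label_stab (\<lambda>x. x mod k) {..<k * n}"
proof -
  have "(\<forall>x<k * n. tab_col (replicate n k) (t x) = tab_col (replicate n k) x) \<longleftrightarrow> (\<forall>x. t x mod k = x mod k)"
    if t: "t permutes {..<k * n}" for t
  proof -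
    have "tab_col (replicate n k) (t x) = tab_col (replicate n k) x \<longleftrightarrow> t x mod k = x mod k" if "x < k * n" for x
      using that permutes_in_image[OF t, of x] by (simp add: tab_col_replicate)
    moreover have "t x mod k = x mod k" if "\<not> x < k * n" for x
      using permutes_not_in[OF t, of x] that by simp
    ultimately show ?thesis by blast
  qed
  thus ?thesis
    by (auto simp: column_stabilizer_def label_stab_def symgrp_def sum_list_replicate mult.commute)
qed

lemma young_symmetrizer_replicate:
  assumes "0 < k"
  shows "young_symmetrizer (replicate n k) s =
    (if s \<in> symgrp (k * n) then row_col_sum (\<lambda>x. x div k) (\<lambda>x. x mod k) (k * n) s else 0)"
proof (cases "s \<in> symgrp (k * n)")
  case True
  define H where "H = label_stab (\<lambda>x. x div k) {..<k * n}"
  define V where "V = label_stab (\<lambda>x. x mod k) {..<k * n}"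
  have fin: "finite H" "finite V" by (simp_all add: H_def V_def finite_label_stab)
  have H: "H \<subseteq> symgrp (k * n)" by (auto simp: H_def symgrp_def label_stab_def)
  have row: "(\<Sum>t\<in>H. galg_basis t) h = (if h \<in> H then 1 else 0)" for h
    using fin by (simp add: galg_sum_apply galg_basis_def)
  have col: "(\<Sum>t\<in>V. galg_scale (of_int (sign t)) (galg_basis t)) h = col_sign (\<lambda>x. x mod k) (k * n) h" for h
    using fin by (simp add: galg_sum_apply galg_basis_def galg_scale_def col_sign_def if_distrib cong: if_cong flip: V_def)
  have "young_symmetrizer (replicate n k) s =
      (\<Sum>h\<in>symgrp (k * n). if h \<in> H then col_sign (\<lambda>x. x mod k) (k * n) (pinv h \<circ> s) else 0)"
    using True assms
    by (simp add: young_symmetrizer_def young_subgroup_replicate column_stabilizer_replicate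
        sum_list_replicate mult.commute[of n k] galg_mult_def row col if_distribR if_distrib cong: if_cong
        flip: H_def V_def)
  also have "\<dots> = (\<Sum>h\<in>H. col_sign (\<lambda>x. x mod k) (k * n) (pinv h \<circ> s))"
    using H finite_symgrp by (simp add: sum.If_cases Int_absorb1)
  also have "\<dots> = row_col_sum (\<lambda>x. x div k) (\<lambda>x. x mod k) (k * n) s"
    unfolding row_col_sum_def H_def
    by (rule sum_label_stab_pinv[where f = "\<lambda>h. col_sign (\<lambda>x. x mod k) (k * n) (h \<circ> s)"])
  finally show ?thesis using True by simp
qed (simp add: young_symmetrizer_def galg_mult_def sum_list_replicate mult.commute)

lemma card_block:
  assumes "y < k * n"
  shows "card {x. x < k * n \<and> x div k = y div k} = k"
proof -
  have k: "0 < k" using assms by (cases k) auto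
  have "y div k < n" using assms by (simp add: less_mult_imp_div_less mult.commute)
  hence "k * Suc (y div k) \<le> k * n" by (intro mult_le_mono2) simp
  hence "{x. x < k * n \<and> x div k = y div k} = {x. x div k = y div k}"
    using div_eq_atLeastLessThan[OF k, of "y div k"] by auto
  thus ?thesis by (simp add: div_eq_atLeastLessThan[OF k])
qed

lemma card_block_below: "card {b. b < y \<and> b div k = y div k} = y mod k" for y k :: nat
proof (cases "k = 0")
  case False
  hence k: "0 < k" by simp
  define q where "q = y div k"
  have "y \<in> {x. x div k = q}" by (simp add: q_def)
  hence y: "y < k * Suc q" by (simp add: div_eq_atLeastLessThan[OF k])
  have "{b. b < y \<and> b div k = q} = {..<y} \<inter> {b. b div k = q}" by auto
  also have "\<dots> = {k * q..<y}"
    using y by (auto simp: div_eq_atLeastLessThan[OF k])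
  finally have "{b. b < y \<and> b div k = y div k} = {k * (y div k)..<y}" by (simp add: q_def)
  thus ?thesis by (simp add: minus_mult_div_eq_mod)
qed simp

lemma cycle_coset_sum_blocks_id:
  "cycle_coset_sum (\<lambda>x. x div k) (k * n) a id = (\<Prod>y<k * n. 1 + of_nat (y mod k) * a)"
  by (simp add: cycle_coset_sum_id card_block_below)

lemma prod_mod_power:
  fixes f :: "nat \<Rightarrow> 'a::comm_monoid_mult"
  shows "(\<Prod>y<k * n. f (y mod k)) = (\<Prod>i<k. f i) ^ n"
proof (induction n)
  case (Suc n)
  have "(\<Prod>y<k * n + k. f (y mod k)) = (\<Prod>y<k * n. f (y mod k)) * (\<Prod>y=k * n..<k * n + k. f (y mod k))"
    unfolding lessThan_atLeast0 by (rule prod.atLeastLessThan_concat[symmetric]) auto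
  also have "(\<Prod>y=k * n..<k * n + k. f (y mod k)) = (\<Prod>i<k. f i)"
    using prod.shift_bounds_nat_ivl[of "\<lambda>y. f (y mod k)" 0 "k * n" k]
    by (simp add: lessThan_atLeast0 add.commute)
  finally show ?case using Suc by (simp add: add.commute mult.commute)
qed simp

lemma card_young_subgroup_blocks:
  "of_nat (card (label_stab (\<lambda>x. x div k) {..<k * n})) = (of_nat (fact k ^ n) :: complex)"
proof -
  have "(\<Prod>i<k. 1 + of_nat i) = (fact k :: complex)"
    by (induction k) (simp_all add: algebra_simps)
  thus ?thesis
    using cycle_coset_sum_blocks_id[of k n 1] prod_mod_power[of "\<lambda>i. 1 + of_nat i :: complex" k n]
    by (simp add: cycle_coset_sum_def)
qed

text \<open>
  Every factor \<open>1 - (y mod k) / k\<close> is positive.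
\<close>

lemma cycle_coset_sum_blocks_id_nonzero:
  assumes "0 < k"
  shows "cycle_coset_sum (\<lambda>x. x div k) (k * n) (- 1 / of_nat k) id \<noteq> 0"
proof -
  have "1 + of_nat (y mod k) * (- 1 / of_nat k) \<noteq> (0::complex)" for y
  proof
    assume "1 + of_nat (y mod k) * (- 1 / of_nat k) = (0::complex)"
    hence "(of_nat (y mod k) :: complex) = of_nat k" using assms by (simp add: field_simps)
    thus False using mod_less_divisor[OF assms, of y] by (simp only: of_nat_eq_iff)
  qed
  thus ?thesis unfolding cycle_coset_sum_blocks_id prod_zero_iff[OF finite_lessThan] by blast
qed

section \<open>Wreath determinants as coset sums\<close>

lemma alpha_det_coset:
  assumes g: "g permutes {..<N}" and dim: "dim_row B = N"
    and entries: "\<And>i j. i < N \<Longrightarrow> j < N \<Longrightarrow> B $$ (i, j) = (if l (pinv g i) = l j then 1 else 0)"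
  shows "alpha_det a B = cycle_coset_sum l N a g"
proof -
  have prod: "(\<Prod>i<N. B $$ (s i, i)) = (if pinv g \<circ> s \<in> label_stab l {..<N} then 1 else 0)"
    if "s permutes {..<N}" for s
  proof -
    have p: "pinv g \<circ> s permutes {..<N}" by (intro permutes_compose permutes_inv g that)
    have "pinv g \<circ> s \<in> label_stab l {..<N} \<longleftrightarrow> (\<forall>i<N. l (pinv g (s i)) = l i)"
      using p permutes_not_in[OF p] by (auto simp: label_stab_def) (metis lessThan_iff)
    moreover have "(\<Prod>i<N. B $$ (s i, i)) = (\<Prod>i<N. if l (pinv g (s i)) = l i then 1 else 0)"
      using permutes_in_image[OF that] by (intro prod.cong refl entries) auto
    ultimately show ?thesis by (auto intro: prod.neutral)
  qed
  have "alpha_det a B = (\<Sum>s\<in>symgrp N. if pinv g \<circ> s \<in> label_stab l {..<N} then a ^ nu N s else 0)"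
    unfolding alpha_det_def dim by (intro sum.cong refl) (simp add: prod symgrp_def)
  also have "\<dots> = (\<Sum>s\<in>{s \<in> symgrp N. pinv g \<circ> s \<in> label_stab l {..<N}}. a ^ nu N s)"
    by (rule sum.inter_filter[symmetric, OF finite_symgrp])
  also have "\<dots> = cycle_coset_sum l N a g"
    unfolding cycle_coset_sum_def
    by (rule sum.reindex_bij_witness[where i = "\<lambda>h. g \<circ> h" and j = "\<lambda>s. pinv g \<circ> s"])
      (use g in \<open>auto simp: pinv_o[OF g] symgrp_def intro: permutes_compose label_stab_permutes\<close>)
  finally show ?thesis .
qed

lemma wrdet_rep_id_mat:
  assumes "0 < k"
  shows "wrdet k (rep_id_mat n k) = cycle_coset_sum (\<lambda>x. x div k) (k * n) (- 1 / of_nat k) id"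
  unfolding wrdet_def
  by (rule alpha_det_coset)
    (use assms in \<open>auto simp: rep_id_mat_def kron_def ones_mat_def less_mult_imp_div_less mult.commute\<close>)

text \<open>
  Repeating columns turns \<open>perm_mat (k * n) g * rep_id_mat n k\<close> into the matrix whose \<open>(i, j)\<close> entry
  tests whether \<open>pinv g i\<close> and \<open>j\<close> lie in the same block; a permutation \<open>s\<close> contributes to its \<open>\<alpha>\<close>-determinant exactly when it lies in
  the coset of \<open>g\<close> modulo the row group.
\<close>

lemma wrdet_perm_mat_rep_id_mat:
  assumes "0 < k" and g: "g permutes {..<k * n}"
  shows "wrdet k (perm_mat (k * n) g * rep_id_mat n k) =
    cycle_coset_sum (\<lambda>x. x div k) (k * n) (- 1 / of_nat k) g"
  unfolding wrdet_def
proof (rule alpha_det_coset[OF g])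
  let ?A = "perm_mat (k * n) g * rep_id_mat n k"
  have dim: "dim_row ?A = k * n" "dim_col ?A = n"
    by (simp_all add: perm_mat_def rep_id_mat_def kron_def ones_mat_def)
  show "dim_row (kron ?A (ones_mat 1 k)) = k * n"
    using dim by (simp add: kron_def ones_mat_def)
  have entry: "?A $$ (i, j) = (if pinv g i div k = j then 1 else 0)" if ij: "i < k * n" "j < n" for i j
  proof -
    have "?A $$ (i, j) = (\<Sum>m<k * n. (if i = g m then 1 else 0) * (if m div k = j then 1 else 0))"
      using ij assms(1)
      by (simp add: perm_mat_def rep_id_mat_def kron_def ones_mat_def scalar_prod_def
          less_mult_imp_div_less mult.commute lessThan_atLeast0)
    also have "\<dots> = (\<Sum>m<k * n. if m = pinv g i then (if m div k = j then 1 else 0) else 0)"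
      using permutes_inverses[OF g] by (intro sum.cong refl) auto
    also have "\<dots> = (if pinv g i div k = j then 1 else 0)"
      using permutes_in_image[OF permutes_inv[OF g], of i] ij by simp
    finally show ?thesis .
  qed
  fix i j assume "i < k * n" "j < k * n"
  moreover from this have "j div k < n" by (simp add: less_mult_imp_div_less mult.commute)
  ultimately show "kron ?A (ones_mat 1 k) $$ (i, j) = (if pinv g i div k = j div k then 1 else 0)"
    using dim entry assms(1) by (simp add: kron_def ones_mat_def mult.commute)
qed

section \<open>The character average\<close>

theorem corollary5p4:
  fixes n k :: nat and g :: "nat \<Rightarrow> nat"
  assumes "0 < n" and "0 < k"
    and "g \<in> symgrp (k * n)"
  shows "omega (replicate n k) (replicate n k) g =
    wrdet k (perm_mat (k * n) g * rep_id_mat n k) / wrdet k (rep_id_mat n k)"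
proof -
  define N where "N = k * n"
  define H where "H = label_stab (\<lambda>x. x div k) {..<N}"
  define r where "r = row_col_sum (\<lambda>x. x div k) (\<lambda>x. x mod k) N"
  define e where "e = young_symmetrizer (replicate n k)"
  define W where "W = cycle_coset_sum (\<lambda>x. x div k) N (- 1 / of_nat k)"
  define M where "M = irrep (replicate n k)"
  have g: "g permutes {..<N}" using assms(3) by (simp add: symgrp_def N_def)
  have W0: "W id \<noteq> 0"
    unfolding W_def N_def by (rule cycle_coset_sum_blocks_id_nonzero[OF assms(2)])
  have e: "e s = (if s \<in> symgrp N then r s else 0)" for s
    unfolding e_def r_def N_def by (rule young_symmetrizer_replicate[OF assms(2)])
  have "inj_on (\<lambda>x. (x div k, x mod k)) {..<N}"
    by (rule inj_onI) (metis div_mult_mod_eq prod.inject)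
  hence r_id: "r id = 1" unfolding r_def by (rule row_col_sum_id)
  have sym: "N = sum_list (replicate n k)" by (simp add: N_def sum_list_replicate)
  have inv_sym: "pinv h \<circ> s \<in> symgrp N" if "h \<in> symgrp N" "s \<in> symgrp N" for h s
    using that by (auto simp: symgrp_def intro: permutes_compose permutes_inv)
  have H_sym: "H \<subseteq> symgrp N" by (auto simp: H_def symgrp_def label_stab_def)
  have average: "(\<Sum>t\<in>H. r (pinv h \<circ> pinv t \<circ> s)) = of_nat (card H) * W h / W id * r s"
    if "h \<in> symgrp N" "s \<in> symgrp N" for h s
  proof -
    have "(\<Sum>t\<in>H. r (pinv h \<circ> pinv t \<circ> s)) = (\<Sum>t\<in>H. r (pinv h \<circ> t \<circ> s))"
      unfolding H_def by (rule sum_label_stab_pinv[where f = "\<lambda>t. r (pinv h \<circ> t \<circ> s)"])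
    also have "\<dots> = of_nat (card H) * W h / W id * r s"
      unfolding H_def r_def W_def
      by (rule row_average_row_col_sum)
        (use assms(2) that W0 card_block[of _ k n] in \<open>auto simp: W_def N_def symgrp_def\<close>)
    finally show ?thesis .
  qed
  \<comment> \<open>The coefficient of the identity in \<open>a x\<close>, with \<open>a\<close> the sum of \<open>H\<close>. Since \<open>e\<close> has coefficient 1
      there and \<open>a x\<close> is a multiple of \<open>e\<close> for \<open>x\<close> in \<open>M\<close>, the multiple is \<open>f x\<close>.\<close>
  define f where "f x = (\<Sum>t\<in>H. x (pinv t))" for x :: galg
  have M: "M = {galg_mult N x e | x. x \<in> galg_carrier N}"
    unfolding M_def irrep_def e_def sym ..
  hence M_span: "M = galg.span ((\<lambda>h. galg_mult N (galg_basis h) e) ` symgrp N)"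
    by (simp add: left_ideal_span)
  have M_inv: "galg_mult N (galg_basis h) x \<in> M" if h: "h \<in> symgrp N" and x: "x \<in> M" for h x
  proof -
    obtain y where y: "y \<in> galg_carrier N" "x = galg_mult N y e" using x M by blast
    have "(\<lambda>s. y (pinv h \<circ> s)) \<in> galg_carrier N"
      unfolding galg_carrier_def
    proof (intro CollectI allI impI)
      fix s assume s: "s \<notin> symgrp N"
      have "pinv h \<circ> s \<notin> symgrp N"
      proof
        assume "pinv h \<circ> s \<in> symgrp N"
        hence "h \<circ> (pinv h \<circ> s) \<in> symgrp N"
          using h by (auto simp: symgrp_def simp del: o_assoc intro: permutes_compose)
        thus False using s h pinv_o(2)[of h "{..<N}" s] by (simp add: symgrp_def)
      qed
      thus "y (pinv h \<circ> s) = 0" using y(1) by (simp add: galg_carrier_def)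
    qed
    thus ?thesis using y(2) galg_mult_assoc_basis[OF h, of y e] M by blast
  qed
  \<comment> \<open>\<open>g a x = f x \<cdot> g e\<close>\<close>
  have rank1: "(\<Sum>t\<in>H. galg_mult N (galg_basis (g \<circ> t)) x) = galg_scale (f x) (galg_mult N (galg_basis g) e)"
    if xM: "x \<in> M" for x
  proof
    fix s
    obtain y where x: "x = galg_mult N y e" using xM M by blast
    have val: "(\<Sum>t\<in>H. x (pinv t \<circ> s)) = (\<Sum>h\<in>symgrp N. y h * (of_nat (card H) * W h / W id)) * r s"
      if s: "s \<in> symgrp N" for s
    proof -
      have "(\<Sum>t\<in>H. x (pinv t \<circ> s)) = (\<Sum>t\<in>H. \<Sum>h\<in>symgrp N. y h * r (pinv h \<circ> pinv t \<circ> s))"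
        using H_sym s inv_sym
        by (intro sum.cong refl) (auto simp: x galg_mult_def e comp_assoc subset_iff intro!: sum.cong)
      also have "\<dots> = (\<Sum>h\<in>symgrp N. y h * (\<Sum>t\<in>H. r (pinv h \<circ> pinv t \<circ> s)))"
        by (subst sum.swap) (simp add: sum_distrib_left)
      also have "\<dots> = (\<Sum>h\<in>symgrp N. y h * (of_nat (card H) * W h / W id)) * r s"
        using average s by (simp add: sum_distrib_right mult.assoc)
      finally show ?thesis .
    qed
    have f: "f x = (\<Sum>h\<in>symgrp N. y h * (of_nat (card H) * W h / W id))"
      using val[of id] by (simp add: f_def r_id symgrp_def)
    show "(\<Sum>t\<in>H. galg_mult N (galg_basis (g \<circ> t)) x) s =
        galg_scale (f x) (galg_mult N (galg_basis g) e) s"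
    proof (cases "s \<in> symgrp N")
      case True
      have gs: "pinv g \<circ> s \<in> symgrp N" using inv_sym True assms(3) by (simp add: N_def)
      have "galg_mult N (galg_basis (g \<circ> t)) x s = x (pinv t \<circ> (pinv g \<circ> s))" if "t \<in> H" for t
      proof -
        have t: "t permutes {..<N}" using that H_sym by (auto simp: symgrp_def)
        hence "g \<circ> t \<in> symgrp N" using g by (simp add: symgrp_def permutes_compose)
        moreover have "pinv (g \<circ> t) = pinv t \<circ> pinv g"
          using g t by (intro o_inv_distrib permutes_bij)
        ultimately show ?thesis using True by (simp add: galg_mult_basis comp_assoc)
      qed
      thus ?thesis
        using val[OF gs] gs True assms(3)
        by (simp add: galg_sum_apply galg_scale_def galg_mult_basis e f N_def[symmetric])
    qed (simp add: galg_sum_apply galg_scale_def galg_mult_def)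
  qed
  have "(\<Sum>t\<in>H. irr_char (replicate n k) (g \<circ> t)) =
      (\<Sum>t\<in>H. trace_on M (galg_mult N (galg_basis (g \<circ> t))))"
    by (simp add: irr_char_def M_def sym)
  also have "\<dots> = f (galg_mult N (galg_basis g) e)"
  proof (rule trace_on_sum_rank_one[where f = f and v = "galg_mult N (galg_basis g) e", OF _ M_span])
    show "finite ((\<lambda>h. galg_mult N (galg_basis h) e) ` symgrp N)" by (simp add: finite_symgrp)
    show "galg_mult N (galg_basis g) e \<in> M"
      unfolding M_span using assms(3) by (intro galg.span_base) (simp add: N_def)
    show "additive f" by unfold_locales (simp add: f_def sum.distrib)
    show "f (galg_scale c x) = c * f x" for c x
      by (simp add: f_def galg_scale_def sum_distrib_left)
    show "galg_mult N (galg_basis (g \<circ> t)) x \<in> M" if "t \<in> H" "x \<in> M" for t x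
      using that H_sym g by (intro M_inv) (auto simp: symgrp_def intro: permutes_compose)
  qed (rule rank1)
  also have "\<dots> = (\<Sum>t\<in>H. r (pinv g \<circ> pinv t \<circ> id))"
  proof -
    have "pinv t \<in> symgrp N" if "t \<in> H" for t
      using that H_sym by (auto simp: symgrp_def intro: permutes_inv)
    thus ?thesis
      using inv_sym assms(3) unfolding f_def
      by (intro sum.cong refl) (simp add: galg_mult_basis e N_def[symmetric])
  qed
  also have "\<dots> = of_nat (card H) * W g / W id"
    using average[of g id] assms(3) r_id by (simp add: symgrp_def N_def)
  finally have "omega (replicate n k) (replicate n k) g =
      1 / of_nat (fact k ^ n) * (of_nat (card H) * W g / W id)"
    using young_subgroup_replicate[OF assms(2), of n]
    by (simp add: omega_def H_def N_def)
  also have "\<dots> = W g / W id"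
    unfolding H_def N_def card_young_subgroup_blocks by simp
  also have "\<dots> = wrdet k (perm_mat (k * n) g * rep_id_mat n k) / wrdet k (rep_id_mat n k)"
    using wrdet_rep_id_mat[OF assms(2), of n] wrdet_perm_mat_rep_id_mat[OF assms(2) g[unfolded N_def]]
    by (simp add: W_def N_def)
  finally show ?thesis .
qed

end
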